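(* Let $s_1<\cdots<s_n$ be arbitrary positive integers ($n\ge 1$). Let $v_1,\dots,v_{s_n}$ be the columns of a real matrix $A=(a_{ij})_{1\le i\le n,\,1\le j\le s_n}$, where the $a_{ij}$'s with $1\le i\le n$ and $1\le j\le s_i$ are generic, and the remaining $a_{ij}$'s are equal to $0$. Then the vector matroid of $v_1,\dots,v_{s_n}$ is isomorphic to the shifted matroid $\mathbf{SM}(s_1,\dots,s_n)$.
   Context: Generic: given real numbers $x_1,\dots,x_k$, let $x_S=\prod_{i\in S}x_i$ for each $S\subseteq[k]=\{1,\dots,k\}$ (with $x_\emptyset=1$). Form all $2^{2^k}$ possible sums of some of the $x_S$'s, i.e. the sums $\sum_{S\in\mathcal{F}}x_S$ over all families $\mathcal{F}$ of subsets of $[k]$. The collection $x_1,\dots,x_k$ is called generic if these $2^{2^k}$ sums are all distinct. Here genericity refers to the whole collection of entries $a_{ij}$ with $1\le i\le n$, $1\le j\le s_i$. The vector matroid of an indexed family of vectors is the matroid on the index set whose independent sets are the index sets of linearly independent subfamilies. The shifted matroid $\mathbf{SM}(s_1,\dots,s_n)$ is the matroid on the ground set $[s_n]$ whose bases are the sets $\{a_1<\cdots<a_n\}$ of positive integers with $a_i\le s_i$ for all $1\le i\le n$. *)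

theory Defs
  imports Complex_Main "Jordan_Normal_Form.VS_Connect"
begin

text \<open>The family \<open>x\<close> indexed by \<open>K\<close> is generic if the \<open>2 ^ (2 ^ card K)\<close> sums of products
  \<open>x\<^sub>S\<close>, one for each family \<open>F\<close> of subsets \<open>S\<close> of \<open>K\<close>, are distinct.\<close>

definition generic :: "'i set \<Rightarrow> ('i \<Rightarrow> real) \<Rightarrow> bool" where
  "generic K x \<longleftrightarrow> finite K \<and> inj_on (\<lambda>F. \<Sum>S\<in>F. \<Prod>i\<in>S. x i) (Pow (Pow K))"

record 'a indep_system =
  ground :: "'a set"
  indep :: "'a set \<Rightarrow> bool"

definition matroid :: "'a indep_system \<Rightarrow> bool" where
  "matroid M \<longleftrightarrow> finite (ground M) \<and>
    (\<forall>X. indep M X \<longrightarrow> X \<subseteq> ground M) \<and>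
    indep M {} \<and>
    (\<forall>X Y. indep M X \<longrightarrow> Y \<subseteq> X \<longrightarrow> indep M Y) \<and>
    (\<forall>X Y. indep M X \<longrightarrow> indep M Y \<longrightarrow> card X < card Y \<longrightarrow> (\<exists>y\<in>Y - X. indep M (insert y X)))"

definition basis :: "'a indep_system \<Rightarrow> 'a set \<Rightarrow> bool" where
  "basis M B \<longleftrightarrow> indep M B \<and> (\<forall>X. indep M X \<longrightarrow> B \<subseteq> X \<longrightarrow> X = B)"

definition matroid_isomorphic :: "'a indep_system \<Rightarrow> 'b indep_system \<Rightarrow> bool" where
  "matroid_isomorphic M N \<longleftrightarrow>
    (\<exists>f. bij_betw f (ground M) (ground N) \<and> (\<forall>X\<subseteq>ground M. indep M X \<longleftrightarrow> indep N (f ` X)))"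

text \<open>A family of vectors is linearly independent if it has no repetitions and its set of values
  is linearly independent.  Without injectivity, two equal nonzero vectors at different indices
  would wrongly count as independent.\<close>

definition lin_indpt_family :: "nat \<Rightarrow> 'i set \<Rightarrow> ('i \<Rightarrow> 'a :: field vec) \<Rightarrow> bool" where
  "lin_indpt_family n X v \<longleftrightarrow>
    inj_on v X \<and> \<not> module.lin_dep class_ring (module_vec TYPE('a) n) (v ` X)"

definition vector_matroid :: "nat \<Rightarrow> 'i set \<Rightarrow> ('i \<Rightarrow> 'a :: field vec) \<Rightarrow> 'i indep_system" where
  "vector_matroid n E v = \<lparr>ground = E, indep = (\<lambda>X. X \<subseteq> E \<and> lin_indpt_family n X v)\<rparr>"

definition shifted_bases :: "nat \<Rightarrow> (nat \<Rightarrow> nat) \<Rightarrow> nat set set" where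
  "shifted_bases n s =
    {a ` {1..n} | a. strict_mono_on {1..n} a \<and> (\<forall>i\<in>{1..n}. 1 \<le> a i \<and> a i \<le> s i)}"

definition shifted_matroid :: "nat \<Rightarrow> (nat \<Rightarrow> nat) \<Rightarrow> nat indep_system" where
  "shifted_matroid n s =
    \<lparr>ground = {1..s n}, indep = (\<lambda>X. \<exists>B\<in>shifted_bases n s. X \<subseteq> B)\<rparr>"

lemma (in vec_space) lin_indpt_augment:
  assumes "finite A" "A \<subseteq> carrier_vec n" "lin_indpt A"
    and "finite B" "B \<subseteq> carrier_vec n" "lin_indpt B" and "card A < card B"
  shows "\<exists>b\<in>B - A. lin_indpt (insert b A)"
proof (rule ccontr)
  assume neg: "\<not> ?thesis"
  have "B \<subseteq> span A"
  proof
    fix b assume b: "b \<in> B"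
    show "b \<in> span A"
    proof (cases "b \<in> A")
      case True
      then show ?thesis using in_own_span[of A] assms(2) by auto
    next
      case False
      with neg b have "lin_dep (A \<union> {b})" by auto
      with lin_dep_iff_in_span[of A b] False b assms show ?thesis by auto
    qed
  qed
  with replacement[of B A] assms obtain C :: "'a vec set"
    where "int (card C) \<le> int (card A) - int (card B)" by auto
  with assms(7) show False by simp
qed

lemma matroid_vector_matroid:
  fixes v :: "'i \<Rightarrow> 'a :: field vec"
  assumes finE: "finite E" and v: "\<And>i. i \<in> E \<Longrightarrow> v i \<in> carrier_vec n"
  shows "matroid (vector_matroid n E v)"
proof -
  interpret vec_space "TYPE('a)" n .
  have aug: "\<exists>y\<in>Y - X. insert y X \<subseteq> E \<and> lin_indpt_family n (insert y X) v"
    if X: "X \<subseteq> E" "lin_indpt_family n X v" and Y: "Y \<subseteq> E" "lin_indpt_family n Y v"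
      and c: "card X < card Y" for X Y
  proof -
    from X Y have iX: "inj_on v X" "lin_indpt (v ` X)" and iY: "inj_on v Y" "lin_indpt (v ` Y)"
      by (auto simp: lin_indpt_family_def)
    have fX: "finite X" "finite Y" using rev_finite_subset[OF finE] X(1) Y(1) by auto
    have "card (v ` X) < card (v ` Y)" using c iX iY by (simp add: card_image)
    with lin_indpt_augment[of "v ` X" "v ` Y"] fX iX iY X Y v
    obtain b where b: "b \<in> v ` Y - v ` X" "lin_indpt (insert b (v ` X))" by blast
    then obtain y where y: "y \<in> Y" "b = v y" by auto
    with b have "y \<notin> X" by auto
    with y b iX Y X show ?thesis
      by (intro bexI[of _ y]) (auto simp: lin_indpt_family_def)
  qed
  have empty: "lin_indpt {}" by (simp add: lin_dep_def)
  have mono: "lin_indpt U" if "lin_indpt W" "U \<subseteq> W" for U W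
    using that unfolding lin_dep_def by blast
  have down: "lin_indpt_family n Y v" if "lin_indpt_family n X v" "Y \<subseteq> X" for X Y
    using that mono[of "v ` X" "v ` Y"] unfolding lin_indpt_family_def
    by (meson image_mono inj_on_subset)
  show ?thesis
    unfolding matroid_def vector_matroid_def indep_system.simps
  proof (intro conjI allI impI)
    show "lin_indpt_family n {} v" using empty by (simp add: lin_indpt_family_def)
  next
    fix X Y assume "X \<subseteq> E \<and> lin_indpt_family n X v" "Y \<subseteq> X"
    then show "Y \<subseteq> E" "lin_indpt_family n Y v" using down by blast+
  next
    fix X Y assume "X \<subseteq> E \<and> lin_indpt_family n X v" "Y \<subseteq> E \<and> lin_indpt_family n Y v"
      "card X < card Y"
    then show "\<exists>y\<in>Y - X. insert y X \<subseteq> E \<and> lin_indpt_family n (insert y X) v"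
      using aug by blast
  qed (use finE in auto)
qed

lemma shifted_bases_card:
  assumes "B \<in> shifted_bases n s" shows "finite B" "card B = n"
  using assms by (auto simp: shifted_bases_def card_image strict_mono_on_imp_inj_on)

lemma basis_shifted_matroid: "basis (shifted_matroid n s) B \<longleftrightarrow> B \<in> shifted_bases n s"
proof
  assume "basis (shifted_matroid n s) B"
  then show "B \<in> shifted_bases n s"
    unfolding basis_def shifted_matroid_def by auto
next
  assume B: "B \<in> shifted_bases n s"
  have max: "X = B" if "C \<in> shifted_bases n s" "X \<subseteq> C" "B \<subseteq> X" for X C
    using that shifted_bases_card[OF B] shifted_bases_card[OF that(1)]
    by (metis card_subset_eq subset_antisym subset_trans)
  show "basis (shifted_matroid n s) B"
    unfolding basis_def shifted_matroid_def indep_system.simps using B max by blast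
qed

lemma strict_mono_enumeration:
  fixes Y :: "nat set"
  assumes "finite Y" "card Y = n"
  obtains a where "strict_mono_on {1..n} a" "a ` {1..n} = Y"
proof
  let ?l = "sorted_list_of_set Y"
  let ?a = "\<lambda>i. ?l ! (i - 1)"
  have len: "length ?l = n" using assms by simp
  show "strict_mono_on {1..n} ?a"
    using len by (intro strict_mono_onI sorted_wrt_nth_less[where P="(<)"]) auto
  have "?a ` {1..n} = (!) ?l ` {..<n}"
  proof -
    have "(\<lambda>i. i - 1) ` {1..n} = {..<n}"
      by (auto simp: image_iff intro!: bexI[of _ "Suc _"])
    then show ?thesis by (metis (no_types, lifting) image_cong image_image)
  qed
  also have "\<dots> = set ?l" using len by (auto simp: set_conv_nth)
  finally show "?a ` {1..n} = Y" using assms by simp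
qed

lemma matroid_shifted_matroid:
  assumes n: "n \<ge> 1" and s: "strict_mono_on {1..n} s" and pos: "\<And>i. i \<in> {1..n} \<Longrightarrow> s i > 0"
  shows "matroid (shifted_matroid n s)"
proof -
  define t where "t i = (if i = 0 then 0 else s i)" for i
  define P where "P X \<longleftrightarrow> X \<subseteq> {1..s n} \<and> (\<forall>i\<le>n. card {x\<in>X. x > t i} \<le> n - i)" for X
  have s_le: "s i \<le> s j" if "1 \<le> i" "i \<le> j" "j \<le> n" for i j
    using strict_mono_on_leD[OF s, of i j] that by simp
  have finP: "finite X" if "P X" for X
    using that finite_subset unfolding P_def by blast
  have cardP: "card X \<le> n" if "P X" for X
  proof -
    have "{x\<in>X. x > t 0} = X" using that by (auto simp: P_def t_def)
    with that show ?thesis unfolding P_def by (metis diff_zero le0)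
  qed
  have aug: "\<exists>y\<in>Y - X. P (insert y X)" if X: "P X" and Y: "P Y" and c: "card X < card Y" for X Y
  proof -
    have fin: "finite X" "finite Y" using finP X Y by auto
    have ne: "Y - X \<noteq> {}" using c fin card_mono[of X Y] by auto
    define y where "y = Min (Y - X)"
    have y: "y \<in> Y - X" using ne fin Min_in[of "Y - X"] unfolding y_def by blast
    have y_le: "y \<le> z" if "z \<in> Y - X" for z
      using that fin unfolding y_def by simp
    have "card {x \<in> insert y X. x > t i} \<le> n - i" if i: "i \<le> n" for i
    proof (cases "y > t i")
      case False
      then have "{x \<in> insert y X. x > t i} = {x\<in>X. x > t i}" by auto
      with X i show ?thesis by (simp add: P_def)
    next
      case True
      have sub: "{x\<in>Y. x \<le> t i} \<subseteq> {x\<in>X. x \<le> t i}" using y_le True by fastforce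
      have split: "card {x\<in>Z. x \<le> t i} + card {x\<in>Z. x > t i} = card Z" if "finite Z" for Z
        using that
        by (subst card_Un_disjoint[symmetric]) (auto intro!: arg_cong[where f=card])
      have "card {x\<in>Y. x \<le> t i} \<le> card {x\<in>X. x \<le> t i}" using sub fin by (intro card_mono) auto
      then have "card {x\<in>X. x > t i} < card {x\<in>Y. x > t i}"
        using c split[of X] split[of Y] fin by linarith
      also have "\<dots> \<le> n - i" using Y i by (simp add: P_def)
      finally have "Suc (card {x\<in>X. x > t i}) \<le> n - i" by simp
      moreover have "{x \<in> insert y X. x > t i} = insert y {x\<in>X. x > t i}" using True by auto
      ultimately show ?thesis using fin y by simp
    qed
    with X Y y show ?thesis by (intro bexI[of _ y]) (auto simp: P_def)
  qed
  have P_if: "P X" if "X \<subseteq> B" "B \<in> shifted_bases n s" for X B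
  proof -
    from that obtain a where a: "B = a ` {1..n}" "\<And>i. i \<in> {1..n} \<Longrightarrow> 1 \<le> a i \<and> a i \<le> s i"
      by (auto simp: shifted_bases_def)
    have "card {x\<in>X. x > t i} \<le> n - i" if i: "i \<le> n" for i
    proof -
      have "{x\<in>X. x > t i} \<subseteq> a ` {Suc i..n}"
      proof
        fix x assume "x \<in> {x\<in>X. x > t i}"
        then obtain k where k: "k \<in> {1..n}" "x = a k" "a k > t i" using \<open>X \<subseteq> B\<close> a by auto
        have "k > i"
        proof (rule ccontr)
          assume "\<not> k > i"
          then have "a k \<le> t i" using a(2)[of k] s_le[of k i] k i by (auto simp: t_def)
          with k show False by simp
        qed
        with k show "x \<in> a ` {Suc i..n}" by auto
      qed
      then have "card {x\<in>X. x > t i} \<le> card (a ` {Suc i..n})" by (intro card_mono) auto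
      also have "\<dots> \<le> n - i" using card_image_le[of "{Suc i..n}" a] by simp
      finally show ?thesis .
    qed
    moreover have "X \<subseteq> {1..s n}"
    proof
      fix x assume "x \<in> X"
      then obtain k where "k \<in> {1..n}" "x = a k" using \<open>X \<subseteq> B\<close> a(1) by auto
      then show "x \<in> {1..s n}" using a(2)[of k] s_le[of k n] by auto
    qed
    ultimately show ?thesis by (simp add: P_def)
  qed
  have full: "Y \<in> shifted_bases n s" if Y: "P Y" "card Y = n" for Y
  proof -
    have fin: "finite Y" using finP Y by simp
    obtain a where a: "strict_mono_on {1..n} a" "a ` {1..n} = Y"
      using strict_mono_enumeration[OF fin Y(2)] by blast
    have "a i \<le> s i" if i: "i \<in> {1..n}" for i
    proof (rule ccontr)
      assume less: "\<not> a i \<le> s i"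
      have "a ` {i..n} \<subseteq> {x\<in>Y. x > t i}"
      proof
        fix x assume "x \<in> a ` {i..n}"
        then obtain k where k: "k \<in> {i..n}" "x = a k" by auto
        then have "a i \<le> a k" using strict_mono_on_leD[OF a(1), of i k] i by auto
        with k less a(2) i show "x \<in> {x\<in>Y. x > t i}" by (auto simp: t_def)
      qed
      then have "card (a ` {i..n}) \<le> card {x\<in>Y. x > t i}" using fin by (intro card_mono) auto
      also have "\<dots> \<le> n - i" using Y i by (simp add: P_def)
      also have "card (a ` {i..n}) = Suc n - i"
      proof (subst card_image)
        show "inj_on a {i..n}"
          using strict_mono_on_imp_inj_on[OF a(1)] i by (rule_tac inj_on_subset) auto
      qed simp
      finally show False using i by auto
    qed
    moreover have "1 \<le> a i" if "i \<in> {1..n}" for i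
    proof -
      have "a i \<in> Y" using that a(2) by blast
      with Y(1) show ?thesis by (auto simp: P_def)
    qed
    ultimately show ?thesis using a by (auto simp: shifted_bases_def)
  qed
  have top: "s ` {1..n} \<in> shifted_bases n s"
    unfolding shifted_bases_def using s pos
    by (intro CollectI exI[of _ s]) (simp add: Suc_le_eq)
  have ext: "\<exists>B\<in>shifted_bases n s. X \<subseteq> B" if "P X" for X
    using that
  proof (induction "n - card X" arbitrary: X)
    case 0
    then show ?case using full[of X] cardP[of X] by auto
  next
    case (Suc k)
    then have "card X < card (s ` {1..n})" using shifted_bases_card[OF top] by simp
    with aug[OF Suc.prems P_if[OF subset_refl top]]
    obtain y where y: "y \<notin> X" "P (insert y X)" by auto
    with Suc finP[of X] have k: "k = n - card (insert y X)" by simp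
    from Suc.hyps(1)[OF k y(2)] show ?case by blast
  qed
  have indep: "(\<exists>B\<in>shifted_bases n s. X \<subseteq> B) \<longleftrightarrow> P X" for X
    using P_if ext by blast
  have down: "P Y" if "P X" "Y \<subseteq> X" for X Y
    using that unfolding indep[symmetric] by blast
  have ground: "X \<subseteq> {1..s n}" if "P X" for X
    using that unfolding P_def by blast
  have empty: "P {}" by (simp add: P_def)
  show ?thesis
    unfolding matroid_def shifted_matroid_def indep_system.simps indep
    by (intro conjI allI impI)
      (rule finite_atLeastAtMost, erule ground, rule empty, erule (1) down, erule (2) aug)
qed

end

theory Submission
  imports Defs "Jordan_Normal_Form.DL_Rank"
begin

text \<open>Each matroid contains the independent set \<open>s ` {1..n}\<close> of size \<open>n\<close>, so by augmentation it
  suffices to compare the independent sets of size \<open>n\<close>, i.e. to decide when the maximal minor on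
  columns \<open>a\<^sub>1 < \<dots> < a\<^sub>n\<close> vanishes. If \<open>a\<^sub>k > s\<^sub>k\<close> for some \<open>k\<close>, the minor has a zero block in
  rows \<open>1, \<dots>, k\<close> and columns \<open>k, \<dots>, n\<close>, too large for any permutation to avoid. Otherwise the
  diagonal consists of generic entries, and the vanishing of the Leibniz expansion would equate the
  sum of the even monomials with the sum of the odd ones, of which only the former contains the
  diagonal monomial.\<close>

section \<open>Vanishing and nonvanishing of determinants via the Leibniz expansion\<close>

lemma det_eq_0_if_zero_block:
  fixes M :: "'a :: comm_ring_1 mat"
  assumes M: "M \<in> carrier_mat n n" and k: "k < n"
    and zero: "\<And>i j. i \<le> k \<Longrightarrow> k \<le> j \<Longrightarrow> j < n \<Longrightarrow> M $$ (i, j) = 0"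
  shows "det M = 0"
  unfolding det_def'[OF M]
proof (intro sum.neutral ballI)
  fix p assume "p \<in> {p. p permutes {0..<n}}"
  then have p: "p permutes {0..<n}" by simp
  \<comment> \<open>Pigeonhole: an injective \<open>p\<close> cannot send the \<open>k + 1\<close>
    rows \<open>0, ..., k\<close> into the \<open>k\<close> columns below \<open>k\<close>, so every
    Leibniz term meets the zero block.\<close>
  obtain i where i: "i \<le> k" "k \<le> p i"
  proof (rule ccontr)
    assume "\<not> thesis"
    with that have "p ` {..k} \<subseteq> {..<k}" by force
    then have "card (p ` {..k}) \<le> card {..<k}" by (intro card_mono) auto
    then show False by (simp add: card_image permutes_inj_on[OF p])
  qed
  have "p i < n" using permutes_in_image[OF p, of i] i k by simp
  then have "(\<Prod>i = 0..<n. M $$ (i, p i)) = 0"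
    using i k zero[of i "p i"] by (intro prod_zero) (auto intro!: bexI[of _ i])
  then show "signof p * (\<Prod>i = 0..<n. M $$ (i, p i)) = 0" by simp
qed

text \<open>The map \<open>e\<close> labels matrix positions by indices of the generic family, so
  that genericity of a larger array applies to a submatrix with renumbered columns. Positions
  labelled outside \<open>K\<close> hold zeros. Only the diagonal must avoid them.\<close>

lemma det_ne_0_if_generic:
  fixes M :: "real mat"
  assumes M: "M \<in> carrier_mat n n" and K: "generic K x"
    and e: "inj_on e ({0..<n} \<times> {0..<n})"
    and entry: "\<And>i j. i < n \<Longrightarrow> j < n \<Longrightarrow>
      M $$ (i, j) = (if e (i, j) \<in> K then x (e (i, j)) else 0)"
    and diag: "\<And>i. i < n \<Longrightarrow> e (i, i) \<in> K"
  shows "det M \<noteq> 0"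
proof
  \<comment> \<open>\<open>S p\<close> is the set of labels occurring in the Leibniz term of
    \<open>p\<close>. \<open>Q\<close> keeps the permutations whose term meets no forced
    zero.\<close>
  define S where "S p = (\<lambda>i. e (i, p i)) ` {0..<n}" for p
  define Q where "Q = {p. p permutes {0..<n} \<and> S p \<subseteq> K}"
  define Ev where "Ev = {p\<in>Q. evenperm p}"
  define Od where "Od = {p\<in>Q. \<not> evenperm p}"
  have perm: "p permutes {0..<n}" if "p \<in> Q" for p using that by (simp add: Q_def)
  have in_range: "p i < n" if "p permutes {0..<n}" "i < n" for p i
    using permutes_in_image[OF that(1), of i] that(2) by simp
  have fin: "finite Q"
    by (rule finite_subset[OF _ finite_permutations[of "{0..<n}"]]) (auto simp: Q_def)
  \<comment> \<open>As \<open>e\<close> is injective, \<open>S p\<close> determines the graph of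
    \<open>p\<close>. Hence distinct permutations give distinct monomials.\<close>
  have injS: "inj_on S Q"
  proof (rule inj_onI)
    fix p q assume p: "p \<in> Q" and q: "q \<in> Q" and eq: "S p = S q"
    show "p = q"
    proof
      fix i
      show "p i = q i"
      proof (cases "i < n")
        case True
        then have "e (i, p i) \<in> S q" unfolding eq[symmetric] by (simp add: S_def)
        then obtain k where "k < n" "e (i, p i) = e (k, q k)" by (auto simp: S_def)
        then have "(i, p i) = (k, q k)"
          using True in_range[OF perm[OF p], of i] in_range[OF perm[OF q], of k]
          by (intro inj_onD[OF e]) auto
        then show ?thesis by auto
      next
        case False
        then show ?thesis
          using permutes_not_in[OF perm[OF p], of i] permutes_not_in[OF perm[OF q], of i] by simp
      qed
    qed
  qed
  have prod_in: "(\<Prod>i = 0..<n. M $$ (i, p i)) = prod x (S p)" if p: "p \<in> Q" for p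
  proof -
    have "inj_on (\<lambda>i. e (i, p i)) {0..<n}"
      using in_range[OF perm[OF p]] by (auto intro!: inj_onI dest!: inj_onD[OF e])
    then have "prod x (S p) = (\<Prod>i = 0..<n. x (e (i, p i)))"
      unfolding S_def by (simp add: prod.reindex)
    also have "\<dots> = (\<Prod>i = 0..<n. M $$ (i, p i))"
    proof (rule prod.cong)
      fix i assume "i \<in> {0..<n}"
      then have "i < n" "e (i, p i) \<in> K" using p by (auto simp: Q_def S_def)
      then show "x (e (i, p i)) = M $$ (i, p i)" using in_range[OF perm[OF p]] entry by simp
    qed simp
    finally show ?thesis ..
  qed
  have prod_out: "(\<Prod>i = 0..<n. M $$ (i, p i)) = 0" if p: "p permutes {0..<n}" "p \<notin> Q" for p
  proof -
    from p have "\<not> S p \<subseteq> K" by (simp add: Q_def)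
    then obtain i where i: "i < n" "e (i, p i) \<notin> K" unfolding S_def by fastforce
    then have "M $$ (i, p i) = 0" using entry in_range[OF p(1)] by simp
    with i show ?thesis by (intro prod_zero) (auto intro!: bexI[of _ i])
  qed
  assume "det M = 0"
  then have "0 = (\<Sum>p\<in>{p. p permutes {0..<n}}. signof p * (\<Prod>i = 0..<n. M $$ (i, p i)))"
    by (simp add: det_def'[OF M])
  also have "\<dots> = (\<Sum>p\<in>Q. signof p * prod x (S p))"
    using prod_in prod_out
    by (intro sum.mono_neutral_cong_right finite_permutations) (auto simp: Q_def)
  also have "\<dots> = (\<Sum>p\<in>Ev. signof p * prod x (S p)) + (\<Sum>p\<in>Od. signof p * prod x (S p))"
    using fin by (subst sum.union_disjoint[symmetric]) (auto simp: Ev_def Od_def intro!: sum.cong)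
  also have "\<dots> = (\<Sum>p\<in>Ev. prod x (S p)) - (\<Sum>p\<in>Od. prod x (S p))"
    by (simp add: Ev_def Od_def sign_def sum_negf)
  \<comment> \<open>Reindexing along \<open>S\<close> turns sums over permutations into sums over
    families of subsets of \<open>K\<close>, the form in which genericity can compare them.\<close>
  also have "\<dots> = (\<Sum>T\<in>S ` Ev. prod x T) - (\<Sum>T\<in>S ` Od. prod x T)"
    using inj_on_subset[OF injS, of Ev] inj_on_subset[OF injS, of Od]
    by (simp add: sum.reindex Ev_def Od_def subset_eq)
  finally have "(\<Sum>T\<in>S ` Ev. prod x T) = (\<Sum>T\<in>S ` Od. prod x T)" by simp
  moreover have "S ` Ev \<in> Pow (Pow K)" "S ` Od \<in> Pow (Pow K)"
    by (auto simp: Ev_def Od_def Q_def)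
  moreover have "inj_on (\<lambda>F. \<Sum>T\<in>F. prod x T) (Pow (Pow K))" using K by (simp add: generic_def)
  ultimately have eq: "S ` Ev = S ` Od" by (meson inj_onD)
  \<comment> \<open>The diagonal monomial comes from the even permutation \<open>id\<close>.
    Equality of the two families would make it come from an odd one too, against injectivity of
    \<open>S\<close>.\<close>
  have idEv: "id \<in> Ev" using diag by (auto simp: Ev_def Q_def S_def permutes_id evenperm_id)
  with eq obtain p where p: "p \<in> Od" "S id = S p" by blast
  with idEv have "p = id" using inj_onD[OF injS, of id p] by (simp add: Ev_def Od_def)
  with p show False by (simp add: Od_def evenperm_id)
qed

section \<open>Independence of column families, extension in matroids, shifted bases\<close>

lemma lin_indpt_family_image:
  assumes "inj_on f Y"
  shows "lin_indpt_family n (f ` Y) v \<longleftrightarrow> lin_indpt_family n Y (v \<circ> f)"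
  using assms by (auto simp: lin_indpt_family_def image_comp comp_inj_on_iff)

lemma lin_indpt_family_cong:
  assumes "\<And>i. i \<in> X \<Longrightarrow> v i = w i"
  shows "lin_indpt_family n X v \<longleftrightarrow> lin_indpt_family n X w"
  using assms by (simp add: lin_indpt_family_def cong: image_cong inj_on_cong)

text \<open>Both sides express rank \<open>n\<close>: full rank rules out repeated columns as well
  as linear relations, matching the two conditions in \<open>lin_indpt_family\<close>.\<close>

lemma lin_indpt_family_cols_iff_det:
  fixes M :: "'a :: field mat"
  assumes M: "M \<in> carrier_mat n n"
  shows "lin_indpt_family n {0..<n} (col M) \<longleftrightarrow> det M \<noteq> 0"
proof -
  interpret vec_space "TYPE('a)" n .
  have cols: "cols M = map (col M) [0..<n]" using M by (simp add: cols_def)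
  have "distinct (cols M) \<longleftrightarrow> inj_on (col M) {0..<n}" by (simp add: cols distinct_map)
  moreover have "set (cols M) = col M ` {0..<n}" by (simp add: cols)
  moreover have "rank M = n \<longleftrightarrow> distinct (cols M) \<and> lin_indpt (set (cols M))"
    using lin_indpt_full_rank[OF M] full_rank_lin_indpt[OF M] non_distinct_low_rank[OF M]
    by (metis less_irrefl)
  ultimately show ?thesis
    using det_rank_iff[OF M] by (simp add: lin_indpt_family_def)
qed

lemma card_le_if_lin_indpt_family:
  fixes v :: "'i \<Rightarrow> 'a :: field vec"
  assumes v: "\<And>i. i \<in> X \<Longrightarrow> v i \<in> carrier_vec n" and "lin_indpt_family n X v"
  shows "card X \<le> n"
proof -
  interpret vec_space "TYPE('a)" n .
  have "card (v ` X) \<le> dim"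
    using assms by (intro li_le_dim(2)) (auto simp: lin_indpt_family_def)
  with assms(2) show ?thesis by (simp add: lin_indpt_family_def card_image dim_is_n)
qed

text \<open>Augment \<open>X\<close> from the fixed set \<open>Z\<close>, one element at a time,
  until the sizes agree. This reduces the comparison of two matroids to sets of one size.\<close>

lemma matroid_extend_indep:
  assumes M: "matroid M" and "indep M X" "indep M Z" "card X \<le> card Z"
  shows "\<exists>Y. indep M Y \<and> X \<subseteq> Y \<and> card Y = card Z"
  using assms(2,4)
proof (induction "card Z - card X" arbitrary: X)
  case 0
  then show ?case by auto
next
  case (Suc k)
  then have "card X < card Z" by simp
  with M Suc.prems assms(3) obtain y where y: "y \<in> Z - X" "indep M (insert y X)"
    unfolding matroid_def by metis
  have "finite X" using M Suc.prems finite_subset unfolding matroid_def by metis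
  with y have "card (insert y X) = Suc (card X)" by simp
  then have "k = card Z - card (insert y X)" "card (insert y X) \<le> card Z"
    using Suc.hyps(2) \<open>card X < card Z\<close> by simp_all
  with Suc.hyps(1) y(2) show ?case by blast
qed

text \<open>A finite set of naturals has only one increasing enumeration, so the bounds may be
  tested on the given \<open>a\<close> instead of an unknown one.\<close>

lemma shifted_bases_image_iff:
  assumes a: "strict_mono_on {1..n} a" and pos: "\<And>i. i \<in> {1..n} \<Longrightarrow> 1 \<le> a i"
  shows "a ` {1..n} \<in> shifted_bases n s \<longleftrightarrow> (\<forall>i\<in>{1..n}. a i \<le> s i)"
proof
  assume "a ` {1..n} \<in> shifted_bases n s"
  then obtain b where b: "strict_mono_on {1..n} b" "\<forall>i\<in>{1..n}. 1 \<le> b i \<and> b i \<le> s i"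
    and eq: "a ` {1..n} = b ` {1..n}"
    by (auto simp: shifted_bases_def)
  have "a i = b i" if i: "i \<in> {1..n}" for i
  proof -
    \<comment> \<open>The sorted list of the image depends on the image alone, hence so do the
      values of an increasing \<open>c\<close>.\<close>
    have "map c [1..<Suc n] = sorted_list_of_set (c ` {1..n})"
      if c: "strict_mono_on {1..n} c" for c :: "nat \<Rightarrow> nat"
    proof -
      have "sorted_wrt (<) (map c [1..<Suc n])"
        using c by (auto simp: sorted_wrt_iff_nth_less strict_mono_on_def simp del: upt_Suc)
      then have "sorted_list_of_set (set (map c [1..<Suc n])) = map c [1..<Suc n]"
        by (metis sorted_list_of_set.idem_if_sorted_distinct strict_sorted_iff)
      moreover have "set (map c [1..<Suc n]) = c ` {1..n}" by auto
      ultimately show ?thesis by metis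
    qed
    from this[OF a] this[OF b(1)] eq have "map a [1..<Suc n] = map b [1..<Suc n]" by simp
    with i show ?thesis by (simp del: upt_Suc)
  qed
  with b show "\<forall>i\<in>{1..n}. a i \<le> s i" by simp
next
  assume "\<forall>i\<in>{1..n}. a i \<le> s i"
  with a pos show "a ` {1..n} \<in> shifted_bases n s" by (auto simp: shifted_bases_def)
qed

section \<open>Comparison of the vector matroid with the shifted matroid\<close>

theorem theorem5p2:
  fixes n :: nat and s :: "nat \<Rightarrow> nat" and A :: "real mat"
  assumes "n \<ge> 1"
    and "\<And>i. i \<in> {1..n} \<Longrightarrow> s i > 0"
    and "strict_mono_on {1..n} s"
    and "A \<in> carrier_mat n (s n)"
    and "generic (SIGMA i:{1..n}. {1..s i}) (\<lambda>(i, j). A $$ (i - 1, j - 1))"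
    and "\<And>i j. i \<in> {1..n} \<Longrightarrow> j \<in> {1..s n} \<Longrightarrow> s i < j \<Longrightarrow> A $$ (i - 1, j - 1) = 0"
  shows "matroid_isomorphic (vector_matroid n {1..s n} (\<lambda>j. col A (j - 1))) (shifted_matroid n s)"
proof -
  define v where "v = (\<lambda>j. col A (j - 1))"
  let ?V = "vector_matroid n {1..s n} v"
  have s_le: "s i \<le> s j" if "1 \<le> i" "i \<le> j" "j \<le> n" for i j
    using strict_mono_on_leD[OF assms(3), of i j] that by simp
  have key: "lin_indpt_family n B v \<longleftrightarrow> B \<in> shifted_bases n s"
    if B: "B \<subseteq> {1..s n}" "card B = n" for B
  proof -
    have "finite B" using B(1) finite_subset by blast
    then obtain a where a: "strict_mono_on {1..n} a" "a ` {1..n} = B"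
      using strict_mono_enumeration B(2) by blast
    have a_bounds: "1 \<le> a i" "a i \<le> s n" if "i \<in> {1..n}" for i
      using subsetD[OF B(1), of "a i"] a(2) that by auto
    have inj_a: "inj_on a {1..n}" using a(1) by (rule strict_mono_on_imp_inj_on)
    \<comment> \<open>\<open>M\<close> is the square submatrix on the columns in \<open>B\<close>.
      It is indexed from 0 while \<open>a\<close> and \<open>v\<close> are indexed from 1, so column
      \<open>j\<close> of \<open>M\<close> is \<open>v (a (Suc j))\<close>.\<close>
    define M where "M = mat n n (\<lambda>(i, j). A $$ (i, a (Suc j) - 1))"
    have M: "M \<in> carrier_mat n n" by (simp add: M_def)
    have inj: "inj_on (a \<circ> Suc) {0..<n}"
      using inj_a by (intro comp_inj_on) (simp_all add: image_Suc_atLeastLessThan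
          atLeastLessThanSuc_atLeastAtMost)
    have B_eq: "B = (a \<circ> Suc) ` {0..<n}"
      by (simp only: image_comp[symmetric] image_Suc_atLeastLessThan
          atLeastLessThanSuc_atLeastAtMost a(2)[symmetric] One_nat_def)
    have "(v \<circ> (a \<circ> Suc)) j = col M j" if "j \<in> {0..<n}" for j
      using that assms(4) a_bounds[of "Suc j"] by (intro eq_vecI) (auto simp: v_def M_def)
    then have "lin_indpt_family n B v \<longleftrightarrow> det M \<noteq> 0"
      unfolding B_eq lin_indpt_family_image[OF inj] lin_indpt_family_cols_iff_det[OF M, symmetric]
      by (rule lin_indpt_family_cong)
    also have "\<dots> \<longleftrightarrow> (\<forall>i\<in>{1..n}. a i \<le> s i)"
    proof
      assume le: "\<forall>i\<in>{1..n}. a i \<le> s i"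
      show "det M \<noteq> 0"
      \<comment> \<open>Each entry is labelled by its 1-based position in \<open>A\<close>. The
        bounds \<open>a i \<le> s i\<close> place the diagonal among the generic entries.\<close>
      proof (rule det_ne_0_if_generic[OF M assms(5), of "\<lambda>(i, j). (Suc i, a (Suc j))"])
        show "inj_on (\<lambda>(i, j). (Suc i, a (Suc j))) ({0..<n} \<times> {0..<n})"
          using inj by (auto simp: inj_on_def)
      next
        fix i j assume "i < n" "j < n"
        then show "M $$ (i, j) = (if (case (i, j) of (i, j) \<Rightarrow> (Suc i, a (Suc j)))
            \<in> (SIGMA i:{1..n}. {1..s i})
            then case case (i, j) of (i, j) \<Rightarrow> (Suc i, a (Suc j)) of (i, j) \<Rightarrow> A $$ (i - 1, j - 1)
            else 0)"
          using a_bounds[of "Suc j"] assms(6)[of "Suc i" "a (Suc j)"] by (auto simp: M_def)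
      next
        fix i assume "i < n"
        then show "(case (i, i) of (i, j) \<Rightarrow> (Suc i, a (Suc j))) \<in> (SIGMA i:{1..n}. {1..s i})"
          using a_bounds[of "Suc i"] le by auto
      qed
    next
      assume det: "det M \<noteq> 0"
      show "\<forall>i\<in>{1..n}. a i \<le> s i"
      proof (intro ballI, rule ccontr)
        fix k assume k: "k \<in> {1..n}" "\<not> a k \<le> s k"
        \<comment> \<open>For these positions
          \<open>s (Suc i) \<le> s k < a k \<le> a (Suc j)\<close>, so the entry lies in the zero
          region of \<open>A\<close>.\<close>
        have zero: "M $$ (i, j) = 0" if "i \<le> k - 1" "k - 1 \<le> j" "j < n" for i j
        proof -
          have "Suc i \<le> k" using that(1) k(1) by auto
          then have "s (Suc i) \<le> s k" using s_le[of "Suc i" k] k(1) by simp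
          also have "s k < a k" using k by simp
          also have "a k \<le> a (Suc j)"
            using strict_mono_on_leD[OF a(1), of k "Suc j"] that k by simp
          finally show ?thesis
            using assms(6)[of "Suc i" "a (Suc j)"] a_bounds[of "Suc j"] that k
            by (simp add: M_def)
        qed
        have "k - 1 < n" using k(1) by auto
        then have "det M = 0" using zero by (rule det_eq_0_if_zero_block[OF M])
        with det show False by simp
      qed
    qed
    also have "\<dots> \<longleftrightarrow> B \<in> shifted_bases n s"
      using shifted_bases_image_iff[OF a(1), of s] a_bounds(1) a(2) by simp
    finally show ?thesis .
  qed
  have V: "matroid ?V"
    using assms(4) by (intro matroid_vector_matroid) (auto simp: v_def)
  have shifted_sub: "B \<subseteq> {1..s n}" if "B \<in> shifted_bases n s" for B
  proof
    fix x assume "x \<in> B"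
    with that obtain i where "i \<in> {1..n}" "1 \<le> x" "x \<le> s i" by (auto simp: shifted_bases_def)
    with s_le[of i n] show "x \<in> {1..s n}" by simp
  qed
  have shifted_indep: "indep ?V B" if "B \<in> shifted_bases n s" for B
    using key[of B] that shifted_sub[OF that] shifted_bases_card(2)[OF that]
    by (simp add: vector_matroid_def)
  \<comment> \<open>The largest admissible enumeration, \<open>s\<close> itself, supplies an
    independent set of size \<open>n\<close> from which others can be augmented.\<close>
  have top: "s ` {1..n} \<in> shifted_bases n s"
    using shifted_bases_image_iff[OF assms(3)] assms(2) by (simp add: Suc_le_eq)
  have "indep ?V X \<longleftrightarrow> indep (shifted_matroid n s) X" for X
  proof
    \<comment> \<open>Extend \<open>X\<close> to an independent set of exactly \<open>n\<close>
      indices, where \<open>key\<close> applies. The bound \<open>card X \<le> n\<close> makes the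
      extension possible.\<close>
    assume X: "indep ?V X"
    then have "card X \<le> n"
      using assms(4) by (intro card_le_if_lin_indpt_family[of X v])
        (auto simp: vector_matroid_def v_def)
    with matroid_extend_indep[OF V X shifted_indep[OF top]] shifted_bases_card(2)[OF top]
    obtain Y where Y: "indep ?V Y" "X \<subseteq> Y" "card Y = n" by auto
    then have "Y \<in> shifted_bases n s" using key[of Y] by (simp add: vector_matroid_def)
    with Y show "indep (shifted_matroid n s) X" by (auto simp: shifted_matroid_def)
  next
    assume "indep (shifted_matroid n s) X"
    then obtain B where "B \<in> shifted_bases n s" "X \<subseteq> B" by (auto simp: shifted_matroid_def)
    with shifted_indep V show "indep ?V X" unfolding matroid_def by meson
  qed
  then show ?thesis
    unfolding matroid_isomorphic_def v_def[symmetric]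
    by (intro exI[of _ id]) (simp add: vector_matroid_def shifted_matroid_def)
qed

end
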